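(* Define $g,h:[0,1]\to\mathbb{R}$ by $$g(x)=1+\sum_{k=1}^\infty 2^{-k}\sin\big(2\pi\cdot 2^{k^2}x\big),\qquad h(x)=1-\sum_{k=1}^\infty 2^{-k}\sin\big(2\pi\cdot 2^{k^2}x\big),$$ which are continuous non-negative functions, and let $\mu,\nu$ be the probability measures on $[0,1]$ given by $d\mu=g\,dx$ and $d\nu=h\,dx$. Then $\dim_{\mathrm{F}}\mu=\dim_{\mathrm{F}}\nu=0$, while $\mu+\nu$ is twice Lebesgue measure on $[0,1]$ and $\dim_{\mathrm{F}}(\mu+\nu)=1$. In particular, the identity $\dim_{\mathrm{F}}(\mu+\nu)=\min(\dim_{\mathrm{F}}\mu,\dim_{\mathrm{F}}\nu)$ does not hold for all finite Borel measures $\mu,\nu$.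
   Context: For a finite Borel measure $\mu$ on $\mathbb{R}^d$ (here $d=1$; measures on $[0,1]$ are regarded as measures on $\mathbb{R}$), $\widehat\mu(\xi)=\int e^{-2\pi i \xi\cdot x}\,d\mu(x)$ for $\xi\in\mathbb{R}^d$. The notation $f(\xi)\lesssim g(\xi)$ means there is a constant $C$ with $|f(\xi)|\le C|g(\xi)|$ for all $\xi$ (negative powers of $|\xi|$ are read as $+\infty$ at $\xi=0$). The Fourier dimension of $\mu$ is $\dim_{\mathrm{F}}\mu=\sup\{s\in[0,d]:\ \widehat\mu(\xi)\lesssim|\xi|^{-s/2}\}$. *)

theory Defs
  imports "HOL-Probability.Probability"
begin

definition fourier_transform :: "'a::euclidean_space measure \<Rightarrow> 'a \<Rightarrow> complex" where
  "fourier_transform M \<xi> = (\<integral>x. exp (- (2 * complex_of_real pi * \<i> * complex_of_real (\<xi> \<bullet> x))) \<partial>M)"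

(* In Isabelle 0 powr a = 0 for every a, so the frequency 0 is excluded. For s > 0 this is the
   convention that a negative power of 0 is infinite; for s = 0 the bound at frequency 0 only asks
   that C be at least the modulus of the transform there, so it does not affect whether such a C exists. *)
definition fourier_decay :: "'a::euclidean_space measure \<Rightarrow> real \<Rightarrow> bool" where
  "fourier_decay M s \<longleftrightarrow>
     (\<exists>C::real. \<forall>\<xi>. \<xi> \<noteq> 0 \<longrightarrow> norm (fourier_transform M \<xi>) \<le> C * norm \<xi> powr (- s / 2))"

(* For a finite measure the set contains s = 0 and is bounded by the dimension,
   so this real supremum is a genuine one. *)
definition fourier_dim :: "'a::euclidean_space measure \<Rightarrow> real" where
  "fourier_dim M = Sup {s \<in> {0..real DIM('a)}. fourier_decay M s}"

(* Meaningful for measures on the same sigma-algebra; see emeasure_add_measure. *)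
definition add_measure :: "'a measure \<Rightarrow> 'a measure \<Rightarrow> 'a measure" where
  "add_measure M N = measure_of (space M) (sets M) (\<lambda>A. emeasure M A + emeasure N A)"

lemma space_add_measure [simp]: "space (add_measure M N) = space M"
  and sets_add_measure [simp]: "sets (add_measure M N) = sets M"
  by (simp_all add: add_measure_def)

lemma emeasure_add_measure:
  assumes "sets N = sets M" and "A \<in> sets M"
  shows "emeasure (add_measure M N) A = emeasure M A + emeasure N A"
proof (rule emeasure_measure_of[OF add_measure_def])
  show "sets M \<subseteq> Pow (space M)"
    by (rule sets.space_closed)
  show "A \<in> sets (add_measure M N)"
    using assms by simp
  show "positive (sets (add_measure M N)) (\<lambda>A. emeasure M A + emeasure N A)"
    by (simp add: positive_def)
  show "countably_additive (sets (add_measure M N)) (\<lambda>A. emeasure M A + emeasure N A)"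
  proof (rule countably_additiveI)
    fix B :: "nat \<Rightarrow> 'a set"
    assume B: "range B \<subseteq> sets (add_measure M N)" "disjoint_family B"
    have "(\<Sum>i. emeasure M (B i) + emeasure N (B i)) = (\<Sum>i. emeasure M (B i)) + (\<Sum>i. emeasure N (B i))"
      by (intro suminf_add[symmetric] summableI)
    also have "\<dots> = emeasure M (\<Union> (range B)) + emeasure N (\<Union> (range B))"
      using B assms(1) by (simp add: suminf_emeasure)
    finally show "(\<Sum>i. emeasure M (B i) + emeasure N (B i)) =
        emeasure M (\<Union> (range B)) + emeasure N (\<Union> (range B))" .
  qed
qed

(* The measure f dx on [0,1], regarded as a measure on the Borel sets of the line;
   f is only used on [0,1]. *)
definition unit_interval_density :: "(real \<Rightarrow> real) \<Rightarrow> real measure" where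
  "unit_interval_density f = density lborel (\<lambda>x. ennreal (f x) * indicator {0..1} x)"

(* suminf starts at 0, hence the index Suc k for the series over k = 1, 2, ... *)
definition lacunary_series :: "real \<Rightarrow> real" where
  "lacunary_series x = (\<Sum>k. 1 / 2 ^ Suc k * sin (2 * pi * 2 ^ ((Suc k)\<^sup>2) * x))"

definition g :: "real \<Rightarrow> real" where
  "g x = 1 + lacunary_series x"

definition h :: "real \<Rightarrow> real" where
  "h x = 1 - lacunary_series x"

end

theory Submission
  imports Defs "HOL-Real_Asymp.Real_Asymp"
begin

text \<open>By orthogonality of the sines, the imaginary part of the transform of the density
  \<open>1 + c * lacunary_series\<close> at the frequency \<open>2 ^ (k\<^sup>2)\<close> is \<open>- c / 2 ^ (k + 1)\<close>. A bound
  by \<open>C * (2 ^ (k\<^sup>2)) powr (- s / 2)\<close> is, for any \<open>s > 0\<close>, far smaller than this as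
  \<open>k\<close> grows, so there is no power decay at all. In the sum of the two measures the lacunary
  parts cancel, and what is left is an indicator function, whose transform decays like
  \<open>1 / \<bar>\<xi>\<bar>\<close>.\<close>

section \<open>Transform and total mass of a density on [0,1]\<close>

lemma borel_measurable_indicator_times_continuous:
  fixes f :: "real \<Rightarrow> real"
  assumes "continuous_on {0..1} f"
  shows "(\<lambda>x. indicator {0..1} x * f x) \<in> borel_measurable borel"
  using borel_measurable_continuous_on_indicator[OF _ assms] by simp

text \<open>With the indicator inside \<open>ennreal\<close>, the density comes from a real function
  that is Borel measurable as soon as \<open>f\<close> is continuous on [0,1], whatever
  \<open>f\<close> does elsewhere.\<close>

lemma unit_interval_density_eq:
  "unit_interval_density f = density lborel (\<lambda>x. ennreal (indicator {0..1} x * f x))"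
  unfolding unit_interval_density_def
  by (intro arg_cong[of _ _ "density lborel"] ext) (simp split: split_indicator)

text \<open>Passes from the Bochner integral to the gauge integral over [0,1], where antiderivatives
  and uniform limits are easy to use.\<close>

lemma fourier_transform_unit_interval_density:
  assumes cont: "continuous_on {0..1} f" and nonneg: "\<And>x. x \<in> {0..1} \<Longrightarrow> 0 \<le> f x"
  shows "fourier_transform (unit_interval_density f) \<xi> =
    integral {0..1} (\<lambda>x. of_real (f x) * cis (- (2 * pi * \<xi> * x)))"
proof -
  note [measurable] = borel_measurable_indicator_times_continuous[OF cont]
  have exp_eq: "exp (- (2 * complex_of_real pi * \<i> * complex_of_real (\<xi> \<bullet> x))) =
      cis (- (2 * pi * \<xi> * x))" for x
    by (simp add: cis_conv_exp mult_ac)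
  have "fourier_transform (unit_interval_density f) \<xi> =
      (\<integral>x. (indicator {0..1} x * f x) *\<^sub>R cis (- (2 * pi * \<xi> * x)) \<partial>lborel)"
    unfolding fourier_transform_def unit_interval_density_eq exp_eq
    by (rule integral_density) (auto simp: nonneg cis_conv_exp split: split_indicator)
  also have "\<dots> = (LINT x:{0..1}|lborel. of_real (f x) * cis (- (2 * pi * \<xi> * x)))"
    unfolding set_lebesgue_integral_def
    by (intro Bochner_Integration.integral_cong) (auto simp: scaleR_conv_of_real)
  also have "\<dots> = integral {0..1} (\<lambda>x. of_real (f x) * cis (- (2 * pi * \<xi> * x)))"
    by (intro set_borel_integral_eq_integral borel_integrable_atLeastAtMost'
        continuous_intros cont)
  finally show ?thesis .
qed

lemma emeasure_unit_interval_density: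
  assumes cont: "continuous_on {0..1} f" and nonneg: "\<And>x. x \<in> {0..1} \<Longrightarrow> 0 \<le> f x"
  shows "emeasure (unit_interval_density f) UNIV = ennreal (integral {0..1} f)"
proof -
  note [measurable] = borel_measurable_indicator_times_continuous[OF cont]
  have int: "set_integrable lborel {0..1} f"
    by (intro borel_integrable_atLeastAtMost' cont)
  have "emeasure (unit_interval_density f) UNIV = (\<integral>\<^sup>+x. ennreal (indicator {0..1} x * f x) \<partial>lborel)"
    unfolding unit_interval_density_eq by (subst emeasure_density) auto
  also have "\<dots> = ennreal (LINT x:{0..1}|lborel. f x)"
    using int nonneg unfolding set_lebesgue_integral_def set_integrable_def
    by (subst nn_integral_eq_integral) (auto split: split_indicator)
  also have "\<dots> = ennreal (integral {0..1} f)"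
    using set_borel_integral_eq_integral(2)[OF int] by simp
  finally show ?thesis .
qed

section \<open>Orthogonality of sines with integer frequencies\<close>

text \<open>For \<open>n \<noteq> 0\<close> the antiderivative takes the same value at 0 and 1,
  because the frequency is an integer.\<close>

lemma has_integral_sin_period:
  fixes n :: int
  shows "((\<lambda>x. sin (2 * pi * of_int n * x)) has_integral 0) {0..1::real}"
proof (cases "n = 0")
  case False
  have "((\<lambda>x. sin (2 * pi * of_int n * x)) has_integral
      (- cos (2 * pi * of_int n * 1) / (2 * pi * of_int n) - - cos (2 * pi * of_int n * 0) / (2 * pi * of_int n))) {0..1::real}"
    by (rule fundamental_theorem_of_calculus)
      (use False in \<open>auto intro!: derivative_eq_intros simp: has_real_derivative_iff_has_vector_derivative[symmetric]\<close>)
  then show ?thesis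
    using cos_int_2pin[of n] by (simp add: mult_ac del: cos_int_2pin)
qed simp

lemma has_integral_cos_period:
  fixes n :: int
  shows "((\<lambda>x. cos (2 * pi * of_int n * x)) has_integral (if n = 0 then 1 else 0)) {0..1::real}"
proof (cases "n = 0")
  case False
  have "((\<lambda>x. cos (2 * pi * of_int n * x)) has_integral
      (sin (2 * pi * of_int n * 1) / (2 * pi * of_int n) - sin (2 * pi * of_int n * 0) / (2 * pi * of_int n))) {0..1::real}"
    by (rule fundamental_theorem_of_calculus)
      (use False in \<open>auto intro!: derivative_eq_intros simp: has_real_derivative_iff_has_vector_derivative[symmetric]\<close>)
  then show ?thesis
    using False sin_int_2pin[of n] by (simp add: mult_ac del: sin_int_2pin)
next
  case True
  then show ?thesis
    using has_integral_const_real[of "1::real" 0 1] by simp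
qed

text \<open>By the product-to-sum formula only a cosine of frequency 0 contributes. Positivity rules
  out \<open>m + n = 0\<close>, so a contribution arises only from \<open>m - n = 0\<close>.\<close>

lemma has_integral_sin_times_sin:
  fixes m n :: int
  assumes "0 < m" "0 < n"
  shows "((\<lambda>x. sin (2 * pi * of_int m * x) * sin (2 * pi * of_int n * x)) has_integral
    (if m = n then 1 / 2 else 0)) {0..1::real}"
proof -
  have "((\<lambda>x. (cos (2 * pi * of_int (m - n) * x) - cos (2 * pi * of_int (m + n) * x)) / 2) has_integral
    ((if m - n = 0 then 1 else 0) - (if m + n = 0 then 1 else 0)) / 2) {0..1::real}"
    by (intro has_integral_divide has_integral_diff has_integral_cos_period)
  then show ?thesis
    using assms by (simp add: sin_times_sin algebra_simps split: if_splits)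
qed

section \<open>The lacunary series: uniform convergence and termwise integration\<close>

definition lacunary_term :: "nat \<Rightarrow> real \<Rightarrow> real" where
  "lacunary_term k x = 1 / 2 ^ Suc k * sin (2 * pi * 2 ^ ((Suc k)\<^sup>2) * x)"

lemma lacunary_series_eq: "lacunary_series x = (\<Sum>k. lacunary_term k x)"
  by (simp add: lacunary_series_def lacunary_term_def)

lemma abs_lacunary_term_le: "\<bar>lacunary_term k x\<bar> \<le> 1 / 2 ^ Suc k"
  unfolding lacunary_term_def abs_mult using abs_sin_le_one
  by (simp add: mult_left_le divide_simps)

lemma half_power_sums: "(\<lambda>k. 1 / 2 ^ Suc k :: real) sums 1"
  using power_half_series by (simp add: power_divide)

lemma continuous_on_lacunary_term: "continuous_on A (lacunary_term k)"
  unfolding lacunary_term_def by (intro continuous_intros)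

text \<open>Weierstrass M-test with the geometric majorant \<open>1 / 2 ^ Suc k\<close>.\<close>

lemma uniform_limit_lacunary_series:
  "uniform_limit A (\<lambda>n x. \<Sum>k<n. lacunary_term k x) lacunary_series sequentially"
  unfolding lacunary_series_eq[abs_def]
  by (rule Weierstrass_m_test[OF _ sums_summable[OF half_power_sums]])
    (use abs_lacunary_term_le in auto)

lemma continuous_on_lacunary_series: "continuous_on A lacunary_series"
  by (rule uniform_limit_theorem[OF _ uniform_limit_lacunary_series])
    (auto intro!: always_eventually continuous_intros continuous_on_lacunary_term)

lemma abs_lacunary_series_le_1: "\<bar>lacunary_series x\<bar> \<le> 1"
proof -
  have "norm (\<Sum>k. lacunary_term k x) \<le> (\<Sum>k. 1 / 2 ^ Suc k)"
    by (rule norm_suminf_le[OF _ sums_summable[OF half_power_sums]])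
      (use abs_lacunary_term_le in auto)
  then show ?thesis
    using sums_unique[OF half_power_sums] by (simp add: lacunary_series_eq)
qed

text \<open>Termwise integration against a continuous weight. The series and the weight are bounded,
  so multiplying by the weight keeps the convergence uniform, and integrals pass to uniform
  limits.\<close>

lemma has_integral_lacunary_series_times:
  assumes cont: "continuous_on {0..1} \<phi>"
    and sums: "\<And>k. ((\<lambda>x. lacunary_term k x * \<phi> x) has_integral a k) {0..1}" "a sums s"
  shows "((\<lambda>x. lacunary_series x * \<phi> x) has_integral s) {0..1}"
proof -
  have bdd: "bounded (\<phi> ` {0..1})"
    by (intro compact_imp_bounded compact_continuous_image cont) auto
  have "bounded (lacunary_series ` {0..1})"
    using abs_lacunary_series_le_1 by (auto simp: bounded_iff)
  then have lim: "uniform_limit {0..1} (\<lambda>n x. (\<Sum>k<n. lacunary_term k x) * \<phi> x)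
      (\<lambda>x. lacunary_series x * \<phi> x) sequentially"
    using bdd by (intro uniform_lim_mult uniform_limit_lacunary_series uniform_limit_const)
  obtain I J where I: "\<And>n. ((\<lambda>x. (\<Sum>k<n. lacunary_term k x) * \<phi> x) has_integral I n) {0..1}"
    and J: "((\<lambda>x. lacunary_series x * \<phi> x) has_integral J) {0..1}" and "I \<longlonglongrightarrow> J"
    by (rule uniform_limit_integral[OF lim])
      (auto intro!: continuous_intros continuous_on_lacunary_term cont)
  \<comment> \<open>The values \<open>I n\<close> are only known to exist; uniqueness of the
    integral identifies them with the partial sums of \<open>a\<close>.\<close>
  have "I n = (\<Sum>k<n. a k)" for n
  proof (rule has_integral_unique[OF I])
    show "((\<lambda>x. (\<Sum>k<n. lacunary_term k x) * \<phi> x) has_integral (\<Sum>k<n. a k)) {0..1}"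
      unfolding sum_distrib_right by (intro has_integral_sum sums(1)) simp
  qed
  then have "I = (\<lambda>n. \<Sum>k<n. a k)"
    by (rule ext)
  with \<open>I \<longlonglongrightarrow> J\<close> sums(2) have "J = s"
    unfolding sums_def by (simp only: LIMSEQ_unique)
  with J show ?thesis
    by simp
qed

lemma has_integral_lacunary_series: "(lacunary_series has_integral 0) {0..1}"
proof -
  have "((\<lambda>x. lacunary_term k x * 1) has_integral 0) {0..1}" for k
    using has_integral_mult_right[OF has_integral_sin_period[of "2 ^ (Suc k)\<^sup>2"], of "1 / 2 ^ Suc k"]
    by (simp add: lacunary_term_def)
  from has_integral_lacunary_series_times[OF _ this sums_zero] show ?thesis
    by simp
qed

text \<open>Orthogonality leaves only the term of index \<open>m\<close>: its coefficient
  \<open>1 / 2 ^ Suc m\<close> times the integral \<open>1 / 2\<close> of the squared sine.\<close>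

lemma has_integral_lacunary_series_sin:
  "((\<lambda>x. lacunary_series x * sin (2 * pi * 2 ^ ((Suc m)\<^sup>2) * x)) has_integral 1 / 2 ^ (m + 2)) {0..1}"
proof (rule has_integral_lacunary_series_times)
  show "((\<lambda>x. lacunary_term k x * sin (2 * pi * 2 ^ ((Suc m)\<^sup>2) * x)) has_integral
      (if k = m then 1 / 2 ^ (m + 2) else 0)) {0..1}" for k
  proof -
    \<comment> \<open>Distinct indices have distinct frequencies, so the integral of the product of
      sines vanishes unless \<open>k = m\<close>.\<close>
    have "(2::int) ^ (Suc k)\<^sup>2 = 2 ^ (Suc m)\<^sup>2 \<longleftrightarrow> k = m"
      by (simp add: power2_eq_iff_nonneg)
    then show ?thesis
      using has_integral_mult_right[OF has_integral_sin_times_sin[of "2 ^ (Suc k)\<^sup>2" "2 ^ (Suc m)\<^sup>2"],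
          of "1 / 2 ^ Suc k"]
      by (auto simp: lacunary_term_def mult.assoc)
  qed
  show "(\<lambda>k. if k = m then 1 / 2 ^ (m + 2) else 0) sums (1 / 2 ^ (m + 2) :: real)"
    using sums_single[of m "\<lambda>_. 1 / 2 ^ (m + 2) :: real"] by simp
qed (intro continuous_intros)

section \<open>The densities \<open>1 + c * lacunary_series\<close>\<close>

text \<open>The parameter \<open>c\<close> treats \<open>g\<close> (\<open>c = 1\<close>) and
  \<open>h\<close> (\<open>c = - 1\<close>) at once.\<close>

lemma nonneg_lacunary_density:
  assumes "\<bar>c\<bar> \<le> 1"
  shows "0 \<le> 1 + c * lacunary_series x"
proof -
  have "\<bar>c * lacunary_series x\<bar> \<le> 1"
    unfolding abs_mult by (intro mult_le_one assms abs_lacunary_series_le_1 abs_ge_zero)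
  then show ?thesis
    by linarith
qed

text \<open>The modulus is at least that of the imaginary part, which is a sine coefficient of the
  density. The constant 1 contributes nothing to it and the series contributes a single
  term.\<close>

lemma norm_fourier_transform_lacunary_density_ge:
  assumes "\<bar>c\<bar> \<le> 1"
  shows "\<bar>c\<bar> / 2 ^ (m + 2) \<le>
    norm (fourier_transform (unit_interval_density (\<lambda>x. 1 + c * lacunary_series x)) (2 ^ ((Suc m)\<^sup>2)))"
proof -
  define f where "f = (\<lambda>x. 1 + c * lacunary_series x)"
  define N :: real where "N = 2 ^ (Suc m)\<^sup>2"
  have cont: "continuous_on {0..1} f"
    unfolding f_def by (intro continuous_intros continuous_on_lacunary_series)
  have nonneg: "0 \<le> f x" for x
    unfolding f_def by (rule nonneg_lacunary_density[OF assms])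
  have "(\<lambda>x. of_real (f x) * cis (- (2 * pi * N * x))) integrable_on {0..1}"
    by (intro integrable_continuous_real continuous_intros cont)
  then have "((\<lambda>x. of_real (f x) * cis (- (2 * pi * N * x))) has_integral
      fourier_transform (unit_interval_density f) N) {0..1}"
    by (simp add: fourier_transform_unit_interval_density[OF cont nonneg] integrable_integral)
  from has_integral_Im[OF this]
  have "((\<lambda>x. - (f x * sin (2 * pi * N * x))) has_integral
      Im (fourier_transform (unit_interval_density f) N)) {0..1}"
    by simp
  moreover have "((\<lambda>x. - (f x * sin (2 * pi * N * x))) has_integral - (c / 2 ^ (m + 2))) {0..1}"
  proof -
    have "((\<lambda>x. sin (2 * pi * N * x) + c * (lacunary_series x * sin (2 * pi * N * x))) has_integral
        0 + c * (1 / 2 ^ (m + 2))) {0..1}"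
      unfolding N_def
      using has_integral_sin_period[of "2 ^ (Suc m)\<^sup>2"]
      by (intro has_integral_add has_integral_mult_right has_integral_lacunary_series_sin) simp
    from has_integral_neg[OF this] show ?thesis
      by (simp add: f_def algebra_simps)
  qed
  ultimately have "Im (fourier_transform (unit_interval_density f) N) = - (c / 2 ^ (m + 2))"
    by (rule has_integral_unique)
  then have "\<bar>c\<bar> / 2 ^ (m + 2) = \<bar>Im (fourier_transform (unit_interval_density f) N)\<bar>"
    by simp
  also have "\<dots> \<le> norm (fourier_transform (unit_interval_density f) N)"
    by (rule abs_Im_le_cmod)
  finally show ?thesis
    by (simp add: f_def N_def)
qed

text \<open>The exponential has modulus 1, so the total mass serves as the constant. This makes the
  set in \<open>fourier_dim\<close> nonempty.\<close>

lemma fourier_decay_zero: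
  assumes "finite_measure M"
  shows "fourier_decay M 0"
  unfolding fourier_decay_def
proof (intro exI allI impI)
  fix \<xi> :: 'a
  assume "\<xi> \<noteq> 0"
  interpret finite_measure M by fact
  have "norm (fourier_transform M \<xi>) \<le>
      (\<integral>x. norm (exp (- (2 * complex_of_real pi * \<i> * complex_of_real (\<xi> \<bullet> x)))) \<partial>M)"
    unfolding fourier_transform_def by (rule integral_norm_bound)
  then show "norm (fourier_transform M \<xi>) \<le> measure M (space M) * norm \<xi> powr (- 0 / 2)"
    using \<open>\<xi> \<noteq> 0\<close> by simp
qed

text \<open>The series has integral 0 over [0,1], so the mass is that of the constant 1.\<close>

lemma prob_space_lacunary_density:
  assumes "\<bar>c\<bar> \<le> 1"
  shows "prob_space (unit_interval_density (\<lambda>x. 1 + c * lacunary_series x))"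
proof
  have "((\<lambda>x. 1 + c * lacunary_series x) has_integral 1 + c * 0) {0..1}"
    using has_integral_const_real[of "1::real" 0 1]
    by (intro has_integral_add has_integral_mult_right has_integral_lacunary_series) simp
  then have "integral {0..1} (\<lambda>x. 1 + c * lacunary_series x) = 1"
    by (simp add: integral_unique)
  moreover have "continuous_on {0..1} (\<lambda>x. 1 + c * lacunary_series x)"
    by (intro continuous_intros continuous_on_lacunary_series)
  ultimately show "emeasure (unit_interval_density (\<lambda>x. 1 + c * lacunary_series x))
      (space (unit_interval_density (\<lambda>x. 1 + c * lacunary_series x))) = 1"
    using emeasure_unit_interval_density nonneg_lacunary_density[OF assms]
    by (simp add: unit_interval_density_def)
qed

lemma fourier_dim_lacunary_density:
  assumes "\<bar>c\<bar> \<le> 1" "c \<noteq> 0"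
  shows "fourier_dim (unit_interval_density (\<lambda>x. 1 + c * lacunary_series x)) = 0"
proof -
  let ?M = "unit_interval_density (\<lambda>x. 1 + c * lacunary_series x)"
  interpret prob_space ?M
    by (rule prob_space_lacunary_density[OF assms(1)])
  have "fourier_decay ?M 0"
    by (rule fourier_decay_zero[OF finite_measure_axioms])
  moreover have False if decay: "fourier_decay ?M s" and "0 < s" for s
  proof -
    obtain C where C: "norm (fourier_transform ?M \<xi>) \<le> C * norm \<xi> powr (- s / 2)" if "\<xi> \<noteq> 0" for \<xi>
      using decay unfolding fourier_decay_def by blast
    \<comment> \<open>The decay bound at the frequency of index \<open>m\<close>, multiplied through
      by \<open>2 ^ (m + 2)\<close>. The exponent of 2 is then linear in \<open>m\<close> minus a
      quadratic, which for \<open>s > 0\<close> tends to minus infinity.\<close>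
    have "\<bar>c\<bar> \<le> C * 2 powr (real (m + 2) - s / 2 * real (Suc m) ^ 2)" for m
    proof -
      have "(2 ^ (Suc m)\<^sup>2 :: real) powr (- s / 2) = 2 powr (- s / 2 * real (Suc m) ^ 2)"
        by (subst powr_realpow[symmetric]) (simp_all only: powr_powr of_nat_power mult.commute zero_less_numeral)
      then have "\<bar>c\<bar> / 2 ^ (m + 2) \<le> C * 2 powr (- s / 2 * real (Suc m) ^ 2)"
        using order_trans[OF norm_fourier_transform_lacunary_density_ge[OF assms(1), of m] C[of "2 ^ (Suc m)\<^sup>2"]]
        by simp
      then have "\<bar>c\<bar> \<le> C * 2 powr (- s / 2 * real (Suc m) ^ 2) * 2 powr real (m + 2)"
        by (subst powr_realpow) (auto simp: pos_divide_le_eq)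
      then show ?thesis
        by (simp add: powr_add[symmetric] mult.assoc algebra_simps)
    qed
    moreover have "(\<lambda>m. C * 2 powr (real (m + 2) - s / 2 * real (Suc m) ^ 2)) \<longlonglongrightarrow> 0"
      using \<open>0 < s\<close> by real_asymp
    ultimately have "\<bar>c\<bar> \<le> 0"
      by (intro LIMSEQ_le_const) auto
    with \<open>c \<noteq> 0\<close> show False
      by simp
  qed
  \<comment> \<open>No positive \<open>s\<close> is admissible and 0 is, so the supremum is taken
    over a singleton.\<close>
  ultimately have "{s \<in> {0..real DIM(real)}. fourier_decay ?M s} = {0}"
    by (force simp: less_le)
  then show ?thesis
    by (simp add: fourier_dim_def)
qed

section \<open>Decay for the constant density 2\<close>

text \<open>The first bound is the total mass and serves small frequencies; the second comes from an
  explicit antiderivative and serves large ones.\<close>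

lemma norm_fourier_transform_uniform_le:
  "norm (fourier_transform (unit_interval_density (\<lambda>_. 2)) \<xi>) \<le> 2"
  "\<xi> \<noteq> 0 \<Longrightarrow> norm (fourier_transform (unit_interval_density (\<lambda>_. 2)) \<xi>) \<le> 2 / \<bar>\<xi>\<bar>"
proof -
  have eq: "fourier_transform (unit_interval_density (\<lambda>_. 2)) \<xi> =
      integral {0..1} (\<lambda>x. 2 * cis (- (2 * pi * \<xi> * x)))"
    by (subst fourier_transform_unit_interval_density) auto
  have "norm (integral {0..1} (\<lambda>x. 2 * cis (- (2 * pi * \<xi> * x)))) \<le> 2 * (1 - 0)"
    by (rule integral_bound) (auto intro!: continuous_intros simp: norm_mult)
  then show "norm (fourier_transform (unit_interval_density (\<lambda>_. 2)) \<xi>) \<le> 2"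
    by (simp add: eq)
  assume "\<xi> \<noteq> 0"
  \<comment> \<open>An antiderivative of the integrand: the factor
    \<open>2 / (- 2 * pi * \<i> * \<xi>)\<close> equals \<open>\<i> / (pi * \<xi>)\<close>. The
    modulus of \<open>F\<close> is constantly \<open>1 / (pi * \<bar>\<xi>\<bar>)\<close>.\<close>
  define F where "F x = \<i> / (pi * \<xi>) * cis (- (2 * pi * \<xi> * x))" for x
  have "((\<lambda>x. 2 * cis (- (2 * pi * \<xi> * x))) has_integral F 1 - F 0) {0..1}"
  proof (rule fundamental_theorem_of_calculus)
    show "(F has_vector_derivative 2 * cis (- (2 * pi * \<xi> * x))) (at x within {0..1})" for x
      unfolding F_def cis_conv_exp using \<open>\<xi> \<noteq> 0\<close>
      by (auto intro!: derivative_eq_intros has_vector_derivative_real_field simp: field_simps)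
  qed simp
  then have "fourier_transform (unit_interval_density (\<lambda>_. 2)) \<xi> = F 1 - F 0"
    unfolding eq by (rule integral_unique)
  also have "norm \<dots> \<le> norm (F 1) + norm (F 0)"
    by (rule norm_triangle_ineq4)
  also have "\<dots> = 2 / (pi * \<bar>\<xi>\<bar>)"
    by (simp add: F_def norm_mult norm_divide abs_mult)
  also have "\<dots> \<le> 2 / \<bar>\<xi>\<bar>"
    using \<open>\<xi> \<noteq> 0\<close> pi_ge_two by (intro divide_left_mono) auto
  finally show "norm (fourier_transform (unit_interval_density (\<lambda>_. 2)) \<xi>) \<le> 2 / \<bar>\<xi>\<bar>" .
qed

text \<open>The definition caps \<open>s\<close> at the dimension 1 of the line, so decay of order
  \<open>1 / 2\<close> suffices, and the supremum is attained at \<open>s = 1\<close>.\<close>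

lemma fourier_dim_uniform: "fourier_dim (unit_interval_density (\<lambda>_. 2)) = 1"
proof -
  let ?T = "fourier_transform (unit_interval_density (\<lambda>_. 2))"
  have "norm (?T \<xi>) \<le> 2 * norm \<xi> powr (- 1 / 2)" if "\<xi> \<noteq> 0" for \<xi>
  \<comment> \<open>Up to modulus 1 the power \<open>\<bar>\<xi>\<bar> powr (- 1 / 2)\<close> is at
    least 1, so the mass bound is enough. Beyond 1 it dominates
    \<open>1 / \<bar>\<xi>\<bar>\<close>.\<close>
  proof (cases "\<bar>\<xi>\<bar> \<le> 1")
    case True
    have "1 = 1 powr (- 1 / 2 :: real)"
      by simp
    also have "\<dots> \<le> \<bar>\<xi>\<bar> powr (- 1 / 2)"
      using True that by (intro powr_mono2') auto
    finally show ?thesis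
      using norm_fourier_transform_uniform_le(1)[of \<xi>] by simp
  next
    case False
    then have "\<bar>\<xi>\<bar> powr (- 1) \<le> \<bar>\<xi>\<bar> powr (- 1 / 2)"
      by (intro powr_mono) auto
    then show ?thesis
      using norm_fourier_transform_uniform_le(2)[OF that] that powr_neg_one[of "\<bar>\<xi>\<bar>"] by auto
  qed
  then have "fourier_decay (unit_interval_density (\<lambda>_. 2)) 1"
    unfolding fourier_decay_def by blast
  then show ?thesis
    unfolding fourier_dim_def by (intro cSup_eq_maximum) auto
qed

section \<open>Sums of densities and the counterexample\<close>

lemma add_unit_interval_density:
  assumes "continuous_on {0..1} f" "continuous_on {0..1} f'"
    and "\<And>x. x \<in> {0..1} \<Longrightarrow> 0 \<le> f x" "\<And>x. x \<in> {0..1} \<Longrightarrow> 0 \<le> f' x"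
  shows "add_measure (unit_interval_density f) (unit_interval_density f') =
    unit_interval_density (\<lambda>x. f x + f' x)"
proof (rule measure_eqI)
  note [measurable] = borel_measurable_indicator_times_continuous[OF assms(1)]
    borel_measurable_indicator_times_continuous[OF assms(2)]
    borel_measurable_indicator_times_continuous[OF continuous_on_add[OF assms(1,2)]]
  fix A
  assume "A \<in> sets (add_measure (unit_interval_density f) (unit_interval_density f'))"
  then have [measurable]: "A \<in> sets borel"
    by (simp add: unit_interval_density_def)
  have "emeasure (add_measure (unit_interval_density f) (unit_interval_density f')) A =
      emeasure (unit_interval_density f) A + emeasure (unit_interval_density f') A"
    by (rule emeasure_add_measure) (simp_all add: unit_interval_density_def)
  also have "\<dots> = (\<integral>\<^sup>+x. ennreal (indicator {0..1} x * f x) * indicator A x +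
      ennreal (indicator {0..1} x * f' x) * indicator A x \<partial>lborel)"
    unfolding unit_interval_density_eq by (simp add: emeasure_density nn_integral_add)
  \<comment> \<open>Nonnegativity enters here: \<open>ennreal\<close> sends negative reals to 0 and
    is additive on nonnegative ones.\<close>
  also have "\<dots> = (\<integral>\<^sup>+x. ennreal (indicator {0..1} x * (f x + f' x)) * indicator A x \<partial>lborel)"
    using assms(3,4) by (intro nn_integral_cong) (simp split: split_indicator)
  also have "\<dots> = emeasure (unit_interval_density (\<lambda>x. f x + f' x)) A"
    unfolding unit_interval_density_eq by (simp add: emeasure_density)
  finally show "emeasure (add_measure (unit_interval_density f) (unit_interval_density f')) A =
      emeasure (unit_interval_density (\<lambda>x. f x + f' x)) A" .
qed (simp add: unit_interval_density_def)

text \<open>Used with \<open>c = 2\<close> to recognise the sum of the two measures as twice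
  Lebesgue measure on [0,1].\<close>

lemma unit_interval_density_const:
  "unit_interval_density (\<lambda>_. c) = scale_measure (ennreal c) (density lborel (indicator {0..1}))"
  by (rule measure_eqI)
    (simp_all add: unit_interval_density_def emeasure_density nn_integral_cmult mult.assoc)

theorem mainTheorem4:
  defines "\<mu> \<equiv> unit_interval_density g" and "\<nu> \<equiv> unit_interval_density h"
  shows "continuous_on {0..1} g \<and> (\<forall>x\<in>{0..1}. 0 \<le> g x) \<and>
    continuous_on {0..1} h \<and> (\<forall>x\<in>{0..1}. 0 \<le> h x) \<and>
    prob_space \<mu> \<and> prob_space \<nu> \<and>
    fourier_dim \<mu> = 0 \<and> fourier_dim \<nu> = 0 \<and>
    add_measure \<mu> \<nu> = scale_measure 2 (density lborel (indicator {0..1})) \<and>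
    fourier_dim (add_measure \<mu> \<nu>) = 1 \<and>
    \<not> (\<forall>M N :: real measure. finite_borel_measure M \<longrightarrow> finite_borel_measure N \<longrightarrow>
          fourier_dim (add_measure M N) = min (fourier_dim M) (fourier_dim N))"
proof -
  have g: "g = (\<lambda>x. 1 + 1 * lacunary_series x)" and h: "h = (\<lambda>x. 1 + (- 1) * lacunary_series x)"
    by (auto simp: g_def h_def)
  have cont: "continuous_on {0..1} g" "continuous_on {0..1} h"
    unfolding g h by (intro continuous_intros continuous_on_lacunary_series)+
  have nonneg: "0 \<le> g x" "0 \<le> h x" for x
    unfolding g h by (rule nonneg_lacunary_density; simp)+
  have prob: "prob_space \<mu>" "prob_space \<nu>"
    unfolding \<mu>_def \<nu>_def g h by (rule prob_space_lacunary_density; simp)+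
  have dim: "fourier_dim \<mu> = 0" "fourier_dim \<nu> = 0"
    unfolding \<mu>_def \<nu>_def g h by (rule fourier_dim_lacunary_density; simp)+
  have add: "add_measure \<mu> \<nu> = unit_interval_density (\<lambda>_. 2)"
    unfolding \<mu>_def \<nu>_def
    by (subst add_unit_interval_density[OF cont nonneg]) (simp add: g_def h_def)
  have borel: "finite_borel_measure \<mu>" "finite_borel_measure \<nu>"
    using prob by (auto simp: finite_borel_measure_def finite_borel_measure_axioms_def
        prob_space_def \<mu>_def \<nu>_def unit_interval_density_def)
  have "fourier_dim (add_measure \<mu> \<nu>) = 1"
    by (simp add: add fourier_dim_uniform)
  moreover have "add_measure \<mu> \<nu> = scale_measure 2 (density lborel (indicator {0..1}))"
    by (simp add: add unit_interval_density_const)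
  moreover have "\<not> (\<forall>M N :: real measure. finite_borel_measure M \<longrightarrow> finite_borel_measure N \<longrightarrow>
      fourier_dim (add_measure M N) = min (fourier_dim M) (fourier_dim N))"
  proof
    assume "\<forall>M N :: real measure. finite_borel_measure M \<longrightarrow> finite_borel_measure N \<longrightarrow>
      fourier_dim (add_measure M N) = min (fourier_dim M) (fourier_dim N)"
    \<comment> \<open>The identity would force \<open>1 = min 0 0\<close>.\<close>
    with borel have "fourier_dim (add_measure \<mu> \<nu>) = min (fourier_dim \<mu>) (fourier_dim \<nu>)"
      by blast
    with dim \<open>fourier_dim (add_measure \<mu> \<nu>) = 1\<close> show False
      by simp
  qed
  ultimately show ?thesis
    using cont nonneg prob dim by blast
qed

end
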